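(* Let $(H;\langle\cdot,\cdot\rangle)$ be a complex Hilbert space, let $e\in H$ with $\|e\|=1$, and let $f\in L([a,b];H)$. Suppose there exist $k_1,k_2\ge 0$ such that $$k_1\|f(t)\|\le \operatorname{Re}\langle f(t),e\rangle,\qquad k_2\|f(t)\|\le \operatorname{Im}\langle f(t),e\rangle$$ for a.e. $t\in[a,b]$. Then $$\sqrt{k_1^2+k_2^2}\int_a^b\|f(t)\|\,dt\le\left\|\int_a^b f(t)\,dt\right\|.$$ Equality holds in this inequality if and only if $$\int_a^b f(t)\,dt=(k_1+ik_2)\left(\int_a^b\|f(t)\|\,dt\right)e.$$
   Context: $L([a,b];H)$ denotes the set of functions $f:[a,b]\to H$ that are Bochner measurable on $[a,b]$ with $\int_a^b\|f(t)\|\,dt$ finite; integrals of $H$-valued functions are Bochner integrals with respect to Lebesgue measure. The inner product is linear in the first variable and conjugate-linear in the second. $i$ is the imaginary unit. *)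

theory Defs
  imports "HOL-Analysis.Analysis"
begin


class scaleC =
  fixes scaleC :: "complex \<Rightarrow> 'a \<Rightarrow> 'a"  (infixr "*\<^sub>C" 75)

class complex_vector = scaleC + real_vector +
  assumes scaleC_add_right: "c *\<^sub>C (x + y) = c *\<^sub>C x + c *\<^sub>C y"
    and scaleC_add_left: "(c + d) *\<^sub>C x = c *\<^sub>C x + d *\<^sub>C x"
    and scaleC_scaleC: "c *\<^sub>C (d *\<^sub>C x) = (c * d) *\<^sub>C x"
    and scaleC_one: "1 *\<^sub>C x = x"
    and scaleR_scaleC: "r *\<^sub>R x = complex_of_real r *\<^sub>C x"

text \<open>The inner product is linear in its first argument and conjugate-linear in its second.
  Definiteness follows from the last axiom, the norm being definite already.\<close>

class complex_inner = complex_vector + real_normed_vector +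
  fixes cinner :: "'a \<Rightarrow> 'a \<Rightarrow> complex"
  assumes cinner_commute: "cinner x y = cnj (cinner y x)"
    and cinner_add_left: "cinner (x + y) z = cinner x z + cinner y z"
    and cinner_scaleC_left: "cinner (c *\<^sub>C x) y = c * cinner x y"
    and cinner_self_ge_zero: "0 \<le> Re (cinner x x)"
    and norm_eq_sqrt_cinner: "norm x = sqrt (Re (cinner x x))"

class complex_hilbert_space = complex_inner + complete_space

instance complex_hilbert_space \<subseteq> banach ..

instantiation complex :: complex_hilbert_space
begin

definition "scaleC_complex (c::complex) (x::complex) = c * x"
definition "cinner_complex (x::complex) (y::complex) = x * cnj y"

instance
proof
  fix c d x y z :: complex and r :: real
  show "c *\<^sub>C (x + y) = c *\<^sub>C x + c *\<^sub>C y" "(c + d) *\<^sub>C x = c *\<^sub>C x + d *\<^sub>C x"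
    "c *\<^sub>C (d *\<^sub>C x) = (c * d) *\<^sub>C x" "1 *\<^sub>C x = x"
    by (simp_all add: scaleC_complex_def algebra_simps)
  show "r *\<^sub>R x = complex_of_real r *\<^sub>C x"
    by (simp add: scaleC_complex_def scaleR_conv_of_real)
  show "cinner x y = cnj (cinner y x)" "cinner (x + y) z = cinner x z + cinner y z"
    "cinner (c *\<^sub>C x) y = c * cinner x y"
    by (simp_all add: cinner_complex_def scaleC_complex_def algebra_simps)
  show "0 \<le> Re (cinner x x)" "norm x = sqrt (Re (cinner x x))"
    by (simp_all add: cinner_complex_def cmod_def power2_eq_square)
qed

end



text \<open>The library predicates \<^const>\<open>has_bochner_integral\<close> and \<^const>\<open>integrable\<close> are restricted
  to second countable codomains, which would exclude non-separable Hilbert spaces. The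
  definitions below drop this restriction by replacing Borel measurability with strong
  measurability.\<close>

definition bochner_measurable :: "'a measure \<Rightarrow> ('a \<Rightarrow> 'b::real_normed_vector) \<Rightarrow> bool" where
  "bochner_measurable M f \<longleftrightarrow>
    (\<exists>s. (\<forall>i. simple_function M (s i)) \<and> (AE x in M. (\<lambda>i. s i x) \<longlonglongrightarrow> f x))"

definition has_strong_bochner_integral ::
    "'a measure \<Rightarrow> ('a \<Rightarrow> 'b::real_normed_vector) \<Rightarrow> 'b \<Rightarrow> bool" where
  "has_strong_bochner_integral M f I \<longleftrightarrow>
    bochner_measurable M f \<and>
    (\<exists>s. (\<forall>i. Bochner_Integration.simple_bochner_integrable M (s i)) \<and>
         (\<lambda>i. \<integral>\<^sup>+x. ennreal (norm (f x - s i x)) \<partial>M) \<longlonglongrightarrow> 0 \<and>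
         (\<lambda>i. Bochner_Integration.simple_bochner_integral M (s i)) \<longlonglongrightarrow> I)"

definition strong_bochner_integral ::
    "'a measure \<Rightarrow> ('a \<Rightarrow> 'b::real_normed_vector) \<Rightarrow> 'b" where
  "strong_bochner_integral M f =
    (if \<exists>I. has_strong_bochner_integral M f I
     then THE I. has_strong_bochner_integral M f I else 0)"

lemma has_bochner_integral_imp_strong:
  fixes f :: "'a \<Rightarrow> 'b::{real_normed_vector, second_countable_topology}"
  assumes "has_bochner_integral M f I"
  shows "has_strong_bochner_integral M f I"
  using assms
proof cases
  case (1 s)
  have "bochner_measurable M f"
  proof -
    obtain u where "\<forall>i. simple_function M (u i)" "\<forall>x\<in>space M. (\<lambda>i. u i x) \<longlonglongrightarrow> f x"
      using borel_measurable_implies_sequence_metric[OF 1(1), of 0] by blast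
    then show ?thesis
      unfolding bochner_measurable_def by (intro exI[of _ u]) (simp add: AE_I2)
  qed
  with 1 show ?thesis
    unfolding has_strong_bochner_integral_def by (intro conjI exI[of _ s]) simp_all
qed

text \<open>The space \<open>L([a,b];H)\<close>; its members are total functions of which only the values on
  \<open>[a,b]\<close> matter.\<close>

definition L_space :: "real \<Rightarrow> real \<Rightarrow> (real \<Rightarrow> 'b::real_normed_vector) set" where
  "L_space a b =
    {f. bochner_measurable (lebesgue_on {a..b}) f \<and>
        (\<integral>\<^sup>+t. ennreal (norm (f t)) \<partial>lebesgue_on {a..b}) < \<infinity>}"

end

theory Submission
  imports Defs
begin

text \<open>The bounded functional \<open>\<langle>\<cdot>, e\<rangle>\<close> commutes with the Bochner integral, so writing
  \<open>I\<close> for the integral of \<open>f\<close> and \<open>N\<close> for that of its norm, integrating the hypotheses gives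
  \<open>k1 N \<le> Re \<langle>I, e\<rangle>\<close> and \<open>k2 N \<le> Im \<langle>I, e\<rangle>\<close>. The inequality follows from
  \<open>\<bar>\<langle>I, e\<rangle>\<bar> \<le> \<parallel>I\<parallel>\<close>. Equality forces equality in this last estimate, hence
  \<open>I = \<langle>I, e\<rangle> e\<close>, and also in both integrated hypotheses.\<close>

section \<open>Complex inner product spaces\<close>

lemma cinner_scaleC_right: "cinner x (c *\<^sub>C y) = cnj c * cinner x (y :: 'a::complex_inner)"
  by (subst (1 2) cinner_commute) (simp add: cinner_scaleC_left)

lemma cinner_add_right: "cinner x (y + z) = cinner x y + cinner x (z :: 'a::complex_inner)"
  by (subst (1 2 3) cinner_commute) (simp add: cinner_add_left)

lemma cinner_self: "cinner x x = complex_of_real ((norm (x :: 'a::complex_inner))\<^sup>2)"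
proof -
  have "Im (cinner x x) = 0"
    using arg_cong[OF cinner_commute[of x x], of Im] by simp
  moreover have "Re (cinner x x) = (norm x)\<^sup>2"
    unfolding norm_eq_sqrt_cinner by (simp only: real_sqrt_pow2 cinner_self_ge_zero)
  ultimately show ?thesis
    by (simp add: complex_eq_iff)
qed

text \<open>The normed-space axioms give homogeneity for real scalars only; for complex ones it
  comes from expanding \<open>cinner (c *\<^sub>C x) (c *\<^sub>C x)\<close>.\<close>

lemma norm_scaleC: "norm (c *\<^sub>C x) = cmod c * norm (x :: 'a::complex_inner)"
proof -
  have "complex_of_real ((norm (c *\<^sub>C x))\<^sup>2) = c * cnj c * cinner x x"
    unfolding cinner_self[symmetric] by (simp add: cinner_scaleC_left cinner_scaleC_right)
  also have "\<dots> = complex_of_real ((cmod c * norm x)\<^sup>2)"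
    by (simp only: cinner_self complex_norm_square[symmetric] power_mult_distrib of_real_mult)
  finally have "(norm (c *\<^sub>C x))\<^sup>2 = (cmod c * norm x)\<^sup>2"
    by (simp only: of_real_eq_iff)
  then show ?thesis
    by (simp add: power2_eq_iff_nonneg)
qed

text \<open>Pythagoras for the orthogonal projection onto the line of \<open>e\<close>.
  Nonnegativity of the left side yields Cauchy-Schwarz against \<open>e\<close>, and its vanishing
  settles the equality case.\<close>

lemma norm_diff_projection:
  fixes x e :: "'a::complex_inner"
  assumes "norm e = 1"
  shows "(norm (x - cinner x e *\<^sub>C e))\<^sup>2 = (norm x)\<^sup>2 - (cmod (cinner x e))\<^sup>2"
proof -
  define c where "c = cinner x e"
  \<comment> \<open>The inner product rules cover sums and scalar multiples, so the difference
    becomes a sum; the factor -1 enters as a real scalar.\<close>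
  have minus: "x - c *\<^sub>C e = x + (- c) *\<^sub>C e"
    using scaleR_scaleC[of "-1" "c *\<^sub>C e"] by (simp add: scaleC_scaleC)
  have ex: "cinner e x = cnj c"
    unfolding c_def by (rule cinner_commute)
  have "cinner (x - c *\<^sub>C e) (x - c *\<^sub>C e) = cinner x x - c * cnj c"
    unfolding minus using assms
    by (simp add: cinner_add_left cinner_add_right cinner_scaleC_left cinner_scaleC_right ex
        cinner_self[of e] flip: c_def)
  also have "\<dots> = complex_of_real ((norm x)\<^sup>2 - (cmod c)\<^sup>2)"
    by (simp only: cinner_self complex_norm_square[symmetric] of_real_diff)
  finally show ?thesis
    by (simp only: cinner_self c_def of_real_eq_iff)
qed

lemma cmod_cinner_le:
  assumes "norm e = 1"
  shows "cmod (cinner x e) \<le> norm (x :: 'a::complex_inner)"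
  using norm_diff_projection[OF assms, of x] zero_le_power2[of "norm (x - cinner x e *\<^sub>C e)"]
  by (simp add: power_mono_iff)

text \<open>Real linearity is all that moving \<open>cinner _ e\<close> through the integral
  requires; Cauchy-Schwarz supplies the bound 1.\<close>

lemma bounded_linear_cinner_left:
  assumes "norm (e :: 'a::complex_inner) = 1"
  shows "bounded_linear (\<lambda>x. cinner x e)"
proof (rule bounded_linear_intro[where K = 1])
  show "cinner (r *\<^sub>R x) e = r *\<^sub>R cinner x e" for r and x :: 'a
    by (simp add: scaleR_scaleC[of r x] cinner_scaleC_left scaleR_conv_of_real)
qed (use cmod_cinner_le[OF assms] in \<open>auto simp: cinner_add_left\<close>)

section \<open>The Bochner integral on a complete measure space\<close>

lemma simple_function_imp_bochner_measurable:
  "simple_function M s \<Longrightarrow> bochner_measurable M s"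
  unfolding bochner_measurable_def by (intro exI[of _ "\<lambda>_. s"]) simp

lemma bochner_measurable_diff:
  assumes "bochner_measurable M f" "bochner_measurable M g"
  shows "bochner_measurable M (\<lambda>x. f x - g x)"
proof -
  obtain s t where s: "\<And>i. simple_function M (s i)" "AE x in M. (\<lambda>i. s i x) \<longlonglongrightarrow> f x"
    and t: "\<And>i. simple_function M (t i)" "AE x in M. (\<lambda>i. t i x) \<longlonglongrightarrow> g x"
    using assms unfolding bochner_measurable_def by blast
  have "AE x in M. (\<lambda>i. s i x - t i x) \<longlonglongrightarrow> f x - g x"
    using s(2) t(2) by eventually_elim (rule tendsto_diff)
  then show ?thesis
    using s(1) t(1) unfolding bochner_measurable_def
    by (intro exI[of _ "\<lambda>i x. s i x - t i x"]) auto
qed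

context complete_measure
begin

text \<open>Preimages under \<open>f\<close> and \<open>g\<close> differ only inside a null set, and
  completeness makes every such modification of a measurable set measurable.\<close>

lemma borel_measurable_AE_cong:
  assumes g: "g \<in> borel_measurable M" and ae: "AE x in M. f x = g x"
  shows "f \<in> borel_measurable M"
proof (rule measurableI)
  fix A :: "'b set"
  assume "A \<in> sets borel"
  then have sets: "g -` A \<inter> space M \<in> sets M"
    by (rule measurable_sets[OF g])
  have "AE x in M. x \<in> g -` A \<inter> space M \<longleftrightarrow> x \<in> f -` A \<inter> space M"
    using ae by eventually_elim auto
  then show "f -` A \<inter> space M \<in> sets M"
    using sets by (rule in_sets_AE) auto
qed auto

lemma bochner_measurable_imp_borel:
  assumes "bochner_measurable M f"
  shows "f \<in> borel_measurable M"
proof -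
  obtain s where s: "\<And>i. simple_function M (s i)" and lim: "AE x in M. (\<lambda>i. s i x) \<longlonglongrightarrow> f x"
    using assms unfolding bochner_measurable_def by blast
  obtain N where N: "N \<in> null_sets M" "{x \<in> space M. \<not> (\<lambda>i. s i x) \<longlonglongrightarrow> f x} \<subseteq> N"
    using lim by (auto elim!: AE_E)
  \<comment> \<open>Zeroing \<open>f\<close> and all \<open>s i\<close> on the exceptional null set
    turns almost everywhere convergence into convergence everywhere, as the limit theorem
    demands.\<close>
  define g where "g x = (if x \<in> N then 0 else f x)" for x
  have "g \<in> borel_measurable M"
  proof (rule borel_measurable_LIMSEQ_metric)
    show "(\<lambda>x. if x \<in> N then 0 else s i x) \<in> borel_measurable M" for i
      using N(1) borel_measurable_simple_function[OF s] by (intro measurable_If_set) auto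
    show "(\<lambda>i. if x \<in> N then 0 else s i x) \<longlonglongrightarrow> g x" if "x \<in> space M" for x
      using N(2) that by (auto simp: g_def)
  qed
  moreover have "AE x in M. f x = g x"
    using AE_not_in[OF N(1)] by eventually_elim (simp add: g_def)
  ultimately show ?thesis
    by (rule borel_measurable_AE_cong)
qed

text \<open>In a non-separable space a difference of Borel functions may fail to be Borel, so the
  argument passes through strong measurability of the difference.\<close>

lemma borel_measurable_norm_diff_simple:
  assumes "bochner_measurable M f" "simple_function M s"
  shows "(\<lambda>x. norm (f x - s x)) \<in> borel_measurable M"
  using bochner_measurable_imp_borel[OF
      bochner_measurable_diff[OF assms(1) simple_function_imp_bochner_measurable[OF assms(2)]]]
  by measurable

section \<open>Uniqueness, existence and bounded operators for the strong integral\<close>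

text \<open>As \<open>simple_bochner_integral_bounded\<close>, which assumes a second countable codomain.\<close>

lemma norm_diff_simple_bochner_integral_le:
  assumes f: "bochner_measurable M f"
    and s: "Bochner_Integration.simple_bochner_integrable M s"
    and t: "Bochner_Integration.simple_bochner_integrable M t"
  shows "ennreal (norm (Bochner_Integration.simple_bochner_integral M s
            - Bochner_Integration.simple_bochner_integral M t)) \<le>
    (\<integral>\<^sup>+x. ennreal (norm (f x - s x)) \<partial>M) + (\<integral>\<^sup>+x. ennreal (norm (f x - t x)) \<partial>M)"
    (is "ennreal (norm (?s - ?t)) \<le> _")
proof -
  have [measurable]: "(\<lambda>x. norm (f x - s x)) \<in> borel_measurable M"
      "(\<lambda>x. norm (f x - t x)) \<in> borel_measurable M"
    using s t
    by (auto intro!: borel_measurable_norm_diff_simple f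
        elim: Bochner_Integration.simple_bochner_integrable.cases)
  have "ennreal (norm (?s - ?t)) =
      norm (Bochner_Integration.simple_bochner_integral M (\<lambda>x. s x - t x))"
    using s t by (subst simple_bochner_integral_diff) auto
  also have "\<dots> \<le> Bochner_Integration.simple_bochner_integral M (\<lambda>x. norm (s x - t x))"
    using simple_bochner_integrable_compose2[of "(-)" M s t] s t
    by (auto intro!: simple_bochner_integral_norm_bound)
  also have "\<dots> = (\<integral>\<^sup>+x. norm (s x - t x) \<partial>M)"
    using simple_bochner_integrable_compose2[of "\<lambda>x y. norm (x - y)" M s t] s t
    by (auto intro!: simple_bochner_integral_eq_nn_integral)
  also have "\<dots> \<le> (\<integral>\<^sup>+x. ennreal (norm (f x - s x)) + ennreal (norm (f x - t x)) \<partial>M)"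
  proof (rule nn_integral_mono)
    fix x
    have "norm (s x - t x) \<le> norm (f x - s x) + norm (f x - t x)"
      by (metis dual_order.refl norm_diff_triangle_le norm_minus_commute)
    then show "ennreal (norm (s x - t x)) \<le> ennreal (norm (f x - s x)) + ennreal (norm (f x - t x))"
      by (simp add: ennreal_leI flip: ennreal_plus)
  qed
  also have "\<dots> = (\<integral>\<^sup>+x. ennreal (norm (f x - s x)) \<partial>M) + (\<integral>\<^sup>+x. ennreal (norm (f x - t x)) \<partial>M)"
    by (rule nn_integral_add) auto
  finally show ?thesis .
qed

text \<open>The integrals of two approximating sequences differ by at most the sum of their L1
  errors, which tends to 0.\<close>

lemma has_strong_bochner_integral_unique:
  assumes "has_strong_bochner_integral M f I" "has_strong_bochner_integral M f J"
  shows "I = J"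
proof -
  obtain s t where f: "bochner_measurable M f"
    and s: "\<And>i. Bochner_Integration.simple_bochner_integrable M (s i)"
      "(\<lambda>i. \<integral>\<^sup>+x. ennreal (norm (f x - s i x)) \<partial>M) \<longlonglongrightarrow> 0"
      "(\<lambda>i. Bochner_Integration.simple_bochner_integral M (s i)) \<longlonglongrightarrow> I"
    and t: "\<And>i. Bochner_Integration.simple_bochner_integrable M (t i)"
      "(\<lambda>i. \<integral>\<^sup>+x. ennreal (norm (f x - t i x)) \<partial>M) \<longlonglongrightarrow> 0"
      "(\<lambda>i. Bochner_Integration.simple_bochner_integral M (t i)) \<longlonglongrightarrow> J"
    using assms unfolding has_strong_bochner_integral_def by blast
  have "(\<lambda>i. ennreal (norm (Bochner_Integration.simple_bochner_integral M (s i)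
            - Bochner_Integration.simple_bochner_integral M (t i)))) \<longlonglongrightarrow> ennreal (norm (I - J))"
    by (intro tendsto_intros s t)
  moreover have "(\<lambda>i. (\<integral>\<^sup>+x. ennreal (norm (f x - s i x)) \<partial>M)
      + (\<integral>\<^sup>+x. ennreal (norm (f x - t i x)) \<partial>M)) \<longlonglongrightarrow> 0 + 0"
    by (intro tendsto_intros s t)
  ultimately have "ennreal (norm (I - J)) \<le> 0 + 0"
    by (rule LIMSEQ_le) (use norm_diff_simple_bochner_integral_le[OF f s(1) t(1)] in blast)
  then show ?thesis
    by simp
qed

lemma strong_bochner_integral_eq:
  assumes "has_strong_bochner_integral M f I"
  shows "strong_bochner_integral M f = I"
proof -
  have "(THE J. has_strong_bochner_integral M f J) = I"
    using assms by (rule the_equality) (rule has_strong_bochner_integral_unique[OF _ assms])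
  then show ?thesis
    using assms by (auto simp: strong_bochner_integral_def)
qed

text \<open>The approximants of a strongly measurable function carry no bound; truncation adds the
  one that dominated convergence uses.\<close>

lemma bochner_measurable_dominated_simple_sequence:
  fixes f :: "'a \<Rightarrow> 'b::real_normed_vector"
  assumes f: "bochner_measurable M f"
  obtains s where "\<And>i. simple_function M (s i)" "\<And>i x. norm (s i x) \<le> 2 * norm (f x)"
    "AE x in M. (\<lambda>i. s i x) \<longlonglongrightarrow> f x"
proof -
  obtain u where u: "\<And>i. simple_function M (u i)" and lim: "AE x in M. (\<lambda>i. u i x) \<longlonglongrightarrow> f x"
    using f unfolding bochner_measurable_def by blast
  have [measurable]: "f \<in> borel_measurable M" "u i \<in> borel_measurable M" for i
    using f u by (auto intro: bochner_measurable_imp_borel borel_measurable_simple_function)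
  \<comment> \<open>Any factor above 1 would do in place of 2: where \<open>f x\<close> is nonzero,
    the slack makes the truncation inactive for large \<open>i\<close>; where \<open>f x\<close> is
    zero, it forces \<open>s i x\<close> to be zero.\<close>
  define s where "s i x = (if norm (u i x) \<le> 2 * norm (f x) then u i x else 0)" for i x
  show thesis
  proof
    show "simple_function M (s i)" for i
      unfolding s_def by (intro simple_function_If u) auto
    show "norm (s i x) \<le> 2 * norm (f x)" for i x
      by (simp add: s_def)
    show "AE x in M. (\<lambda>i. s i x) \<longlonglongrightarrow> f x"
      using lim
    proof eventually_elim
      case (elim x)
      show ?case
      proof (cases "f x = 0")
        case True
        then have "s i x = 0" for i
          by (simp add: s_def)
        then show ?thesis
          using True by simp
      next
        case False
        then have "eventually (\<lambda>i. norm (u i x) < 2 * norm (f x)) sequentially"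
          by (intro order_tendstoD(2)[OF tendsto_norm[OF elim]]) simp
        then have "eventually (\<lambda>i. u i x = s i x) sequentially"
          by eventually_elim (simp add: s_def)
        then show ?thesis
          by (rule Lim_transform_eventually[OF elim])
      qed
    qed
  qed
qed

text \<open>Dominated simple functions converge to \<open>f\<close> in L1, so their integrals form a
  Cauchy sequence, which converges because the codomain is complete.\<close>

lemma has_strong_bochner_integral_ex:
  fixes f :: "'a \<Rightarrow> 'b::banach"
  assumes f: "bochner_measurable M f" and fin: "(\<integral>\<^sup>+x. ennreal (norm (f x)) \<partial>M) < \<infinity>"
  shows "\<exists>I. has_strong_bochner_integral M f I"
proof -
  obtain s where s: "\<And>i. simple_function M (s i)" and dom: "\<And>i x. norm (s i x) \<le> 2 * norm (f x)"
    and lim: "AE x in M. (\<lambda>i. s i x) \<longlonglongrightarrow> f x"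
    using bochner_measurable_dominated_simple_sequence[OF f] by blast
  have [measurable]: "f \<in> borel_measurable M"
    using f by (rule bochner_measurable_imp_borel)
  have fin': "(\<integral>\<^sup>+x. ennreal (c * norm (f x)) \<partial>M) < \<infinity>" if "0 \<le> c" for c
    using fin that by (simp add: ennreal_mult nn_integral_cmult ennreal_mult_less_top)
  have int: "Bochner_Integration.simple_bochner_integrable M (s i)" for i
  proof (rule simple_bochner_integrableI_bounded[OF s])
    have "(\<integral>\<^sup>+x. ennreal (norm (s i x)) \<partial>M) \<le> (\<integral>\<^sup>+x. ennreal (2 * norm (f x)) \<partial>M)"
      by (intro nn_integral_mono ennreal_leI dom)
    then show "(\<integral>\<^sup>+x. ennreal (norm (s i x)) \<partial>M) < \<infinity>"
      using fin'[of 2] by simp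
  qed
  \<comment> \<open>Dominated convergence is applied to the real functions
    \<open>norm (f x - s i x)\<close> with limit 0, avoiding any countability condition on the
    codomain. The constant 3 is 1 for \<open>f\<close> plus 2 for \<open>s i\<close>.\<close>
  have "(\<lambda>i. \<integral>\<^sup>+x. ennreal (norm (0 - norm (f x - s i x))) \<partial>M) \<longlonglongrightarrow> 0"
  proof (rule nn_integral_dominated_convergence_norm[where w = "\<lambda>x. 3 * norm (f x)"])
    show "(\<lambda>x. norm (f x - s i x)) \<in> borel_measurable M" for i
      by (rule borel_measurable_norm_diff_simple[OF f s])
    show "AE x in M. norm (norm (f x - s i x)) \<le> 3 * norm (f x)" for i
    proof (intro AE_I2)
      fix x
      show "norm (norm (f x - s i x)) \<le> 3 * norm (f x)"
        using norm_triangle_ineq4[of "f x" "s i x"] dom[of i x] by simp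
    qed
    show "AE x in M. (\<lambda>i. norm (f x - s i x)) \<longlonglongrightarrow> 0"
      using lim
    proof eventually_elim
      case (elim x)
      show ?case
        using tendsto_norm[OF tendsto_diff[OF tendsto_const elim], of "f x"] by simp
    qed
  qed (use fin'[of 3] in auto)
  then have conv: "(\<lambda>i. \<integral>\<^sup>+x. ennreal (norm (f x - s i x)) \<partial>M) \<longlonglongrightarrow> 0"
    by simp
  have "Cauchy (\<lambda>i. Bochner_Integration.simple_bochner_integral M (s i))"
  proof (rule metric_CauchyI)
    fix r :: real
    assume "0 < r"
    then have "eventually (\<lambda>i. (\<integral>\<^sup>+x. ennreal (norm (f x - s i x)) \<partial>M) < ennreal (r / 2)) sequentially"
      by (intro order_tendstoD(2)[OF conv]) simp
    then obtain n0 where n0: "\<And>i. n0 \<le> i \<Longrightarrow> (\<integral>\<^sup>+x. ennreal (norm (f x - s i x)) \<partial>M) < ennreal (r / 2)"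
      by (auto simp: eventually_sequentially)
    show "\<exists>n0. \<forall>m\<ge>n0. \<forall>n\<ge>n0. dist (Bochner_Integration.simple_bochner_integral M (s m))
        (Bochner_Integration.simple_bochner_integral M (s n)) < r"
    proof (intro exI[of _ n0] allI impI)
      fix m n assume "n0 \<le> m" "n0 \<le> n"
      have "ennreal (norm (Bochner_Integration.simple_bochner_integral M (s m)
            - Bochner_Integration.simple_bochner_integral M (s n)))
          \<le> (\<integral>\<^sup>+x. ennreal (norm (f x - s m x)) \<partial>M) + (\<integral>\<^sup>+x. ennreal (norm (f x - s n x)) \<partial>M)"
        by (rule norm_diff_simple_bochner_integral_le[OF f int int])
      also have "\<dots> < ennreal (r / 2) + ennreal (r / 2)"
        by (intro add_strict_mono n0) fact+
      also have "\<dots> = ennreal r"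
        using \<open>0 < r\<close> by (simp flip: ennreal_plus)
      finally show "dist (Bochner_Integration.simple_bochner_integral M (s m))
          (Bochner_Integration.simple_bochner_integral M (s n)) < r"
        using \<open>0 < r\<close> by (simp add: dist_norm ennreal_less_iff)
    qed
  qed
  then obtain I where "(\<lambda>i. Bochner_Integration.simple_bochner_integral M (s i)) \<longlonglongrightarrow> I"
    using Cauchy_convergent convergentD by blast
  then have "has_strong_bochner_integral M f I"
    unfolding has_strong_bochner_integral_def using f int conv by blast
  then show ?thesis ..
qed

text \<open>The functions \<open>T (s i x)\<close> are simple with integrals \<open>T\<close> of the
  old ones, and the L1 errors grow by at most the factor \<open>K\<close>. A second countable target
  lands the result in the library integral, with its monotonicity rules.\<close>

lemma has_bochner_integral_bounded_linear_strong:
  fixes f :: "'a \<Rightarrow> 'b::real_normed_vector"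
    and T :: "'b \<Rightarrow> 'c::{real_normed_vector, second_countable_topology}"
  assumes T: "bounded_linear T" and fI: "has_strong_bochner_integral M f I"
  shows "has_bochner_integral M (\<lambda>x. T (f x)) (T I)"
proof -
  interpret T: bounded_linear T by (rule T)
  obtain s where f: "bochner_measurable M f"
    and s: "\<And>i. Bochner_Integration.simple_bochner_integrable M (s i)"
    and conv: "(\<lambda>i. \<integral>\<^sup>+x. ennreal (norm (f x - s i x)) \<partial>M) \<longlonglongrightarrow> 0"
    and lim: "(\<lambda>i. Bochner_Integration.simple_bochner_integral M (s i)) \<longlonglongrightarrow> I"
    using fI unfolding has_strong_bochner_integral_def by blast
  obtain K where K: "0 \<le> K" "\<And>x. norm (T x) \<le> norm x * K"
    using T.nonneg_bounded by blast
  show ?thesis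
  proof
    show "(\<lambda>x. T (f x)) \<in> borel_measurable M"
      using bochner_measurable_imp_borel[OF f]
      by (rule measurable_compose) (rule borel_measurable_continuous_onI[OF linear_continuous_on[OF T]])
    show "Bochner_Integration.simple_bochner_integrable M (\<lambda>x. T (s i x))" for i
      \<comment> \<open>The rule for binary operations is used with one that ignores its second
        argument.\<close>
      using simple_bochner_integrable_compose2[of "\<lambda>x y. T x", OF T.zero s s] .
    show "(\<lambda>i. Bochner_Integration.simple_bochner_integral M (\<lambda>x. T (s i x))) \<longlonglongrightarrow> T I"
      unfolding simple_bochner_integral_linear[OF T.linear_axioms s] by (rule T.tendsto[OF lim])
    have bound: "(\<integral>\<^sup>+x. ennreal (norm (T (f x) - T (s i x))) \<partial>M)
        \<le> ennreal K * (\<integral>\<^sup>+x. ennreal (norm (f x - s i x)) \<partial>M)" for i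
    proof -
      have "(\<lambda>x. norm (f x - s i x)) \<in> borel_measurable M"
        using s[of i] by (intro borel_measurable_norm_diff_simple[OF f])
          (auto elim: Bochner_Integration.simple_bochner_integrable.cases)
      then have "ennreal K * (\<integral>\<^sup>+x. ennreal (norm (f x - s i x)) \<partial>M)
          = (\<integral>\<^sup>+x. ennreal (norm (f x - s i x) * K) \<partial>M)"
        using K(1) by (subst nn_integral_cmult[symmetric])
          (auto simp: ennreal_mult mult.commute[of "ennreal K"])
      then show ?thesis
        unfolding T.diff[symmetric] using K(2) by (simp add: nn_integral_mono ennreal_leI)
    qed
    have "(\<lambda>i. ennreal K * (\<integral>\<^sup>+x. ennreal (norm (f x - s i x)) \<partial>M)) \<longlonglongrightarrow> ennreal K * 0"
      by (intro ennreal_tendsto_cmult conv) simp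
    then have "(\<lambda>i. ennreal K * (\<integral>\<^sup>+x. ennreal (norm (f x - s i x)) \<partial>M)) \<longlonglongrightarrow> 0"
      by simp
    then show "(\<lambda>i. \<integral>\<^sup>+x. ennreal (norm (T (f x) - T (s i x))) \<partial>M) \<longlonglongrightarrow> 0"
      by (rule tendsto_sandwich[OF _ _ tendsto_const, rotated 2]) (use bound in \<open>simp_all add: always_eventually\<close>)
  qed
qed

end

text \<open>A null set of the restriction is a null set of \<open>lebesgue\<close>, which is a
  completion and so contains all its subsets.\<close>

lemma complete_measure_lebesgue_on:
  assumes "S \<in> sets lebesgue"
  shows "complete_measure (lebesgue_on S)"
proof
  fix A B :: "'a set"
  assume "B \<subseteq> A" "A \<in> null_sets (lebesgue_on S)"
  then have "A \<in> null_sets lebesgue" "A \<subseteq> S"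
    using assms by (auto simp: null_sets_restrict_space)
  then have "B \<in> sets lebesgue" "B \<subseteq> S"
    using \<open>B \<subseteq> A\<close> completion.complete by blast+
  then show "B \<in> sets (lebesgue_on S)"
    using assms by (simp add: sets_restrict_space_iff)
qed

section \<open>The reverse triangle inequality and its equality case\<close>

theorem theorem1:
  fixes a b k1 k2 :: real
    and e :: "'h::complex_hilbert_space"
    and f :: "real \<Rightarrow> 'h"
  assumes "a \<le> b"
    and "norm e = 1"
    and "f \<in> L_space a b"
    and "0 \<le> k1" and "0 \<le> k2"
    and "AE t in lebesgue_on {a..b}. k1 * norm (f t) \<le> Re (cinner (f t) e)"
    and "AE t in lebesgue_on {a..b}. k2 * norm (f t) \<le> Im (cinner (f t) e)"
  shows "sqrt (k1\<^sup>2 + k2\<^sup>2) * (LINT t|lebesgue_on {a..b}. norm (f t))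
           \<le> norm (strong_bochner_integral (lebesgue_on {a..b}) f) \<and>
         (sqrt (k1\<^sup>2 + k2\<^sup>2) * (LINT t|lebesgue_on {a..b}. norm (f t))
             = norm (strong_bochner_integral (lebesgue_on {a..b}) f) \<longleftrightarrow>
          strong_bochner_integral (lebesgue_on {a..b}) f
             = ((complex_of_real k1 + \<i> * complex_of_real k2)
                 * complex_of_real (LINT t|lebesgue_on {a..b}. norm (f t))) *\<^sub>C e)"
proof -
  interpret complete_measure "lebesgue_on {a..b}"
    by (rule complete_measure_lebesgue_on) simp
  define I where "I = strong_bochner_integral (lebesgue_on {a..b}) f"
  define N where "N = (LINT t|lebesgue_on {a..b}. norm (f t))"
  define z where "z = cinner I e"
  define w where "w = complex_of_real k1 + \<i> * complex_of_real k2"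
  have f: "bochner_measurable (lebesgue_on {a..b}) f"
    and fin: "(\<integral>\<^sup>+t. ennreal (norm (f t)) \<partial>lebesgue_on {a..b}) < \<infinity>"
    using assms(3) by (auto simp: L_space_def)
  have [measurable]: "f \<in> borel_measurable (lebesgue_on {a..b})"
    using f by (rule bochner_measurable_imp_borel)
  have norm_int: "integrable (lebesgue_on {a..b}) (\<lambda>t. norm (f t))"
    using fin by (intro integrableI_bounded) auto
  \<comment> \<open>Existence together with uniqueness identifies the value chosen by
    \<open>THE\<close>.\<close>
  have "has_strong_bochner_integral (lebesgue_on {a..b}) f I"
    using has_strong_bochner_integral_ex[OF f fin] by (auto simp: I_def strong_bochner_integral_eq)
  then have cinner_int: "has_bochner_integral (lebesgue_on {a..b}) (\<lambda>t. cinner (f t) e) z"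
    unfolding z_def
    by (rule has_bochner_integral_bounded_linear_strong[OF bounded_linear_cinner_left[OF assms(2)]])
  have Re_int: "has_bochner_integral (lebesgue_on {a..b}) (\<lambda>t. Re (cinner (f t) e)) (Re z)"
    and Im_int: "has_bochner_integral (lebesgue_on {a..b}) (\<lambda>t. Im (cinner (f t) e)) (Im z)"
    by (rule has_bochner_integral_bounded_linear[OF bounded_linear_Re cinner_int]
        has_bochner_integral_bounded_linear[OF bounded_linear_Im cinner_int])+
  have Re_ge: "k1 * N \<le> Re z"
  proof -
    have "k1 * N = (LINT t|lebesgue_on {a..b}. k1 * norm (f t))"
      by (simp add: N_def)
    also have "\<dots> \<le> (LINT t|lebesgue_on {a..b}. Re (cinner (f t) e))"
      using norm_int Re_int assms(6) by (intro integral_mono_AE) (auto simp: has_bochner_integral_iff)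
    finally show ?thesis
      using Re_int by (simp add: has_bochner_integral_iff)
  qed
  have Im_ge: "k2 * N \<le> Im z"
  proof -
    have "k2 * N = (LINT t|lebesgue_on {a..b}. k2 * norm (f t))"
      by (simp add: N_def)
    also have "\<dots> \<le> (LINT t|lebesgue_on {a..b}. Im (cinner (f t) e))"
      using norm_int Im_int assms(7) by (intro integral_mono_AE) (auto simp: has_bochner_integral_iff)
    finally show ?thesis
      using Im_int by (simp add: has_bochner_integral_iff)
  qed
  have N: "0 \<le> N"
    by (simp add: N_def)
  \<comment> \<open>Since \<open>e\<close> is a unit vector, this is the norm of the proposed
    extremal value \<open>(w * complex_of_real N) *\<^sub>C e\<close>.\<close>
  have norm_w: "cmod (w * complex_of_real N) = sqrt (k1\<^sup>2 + k2\<^sup>2) * N"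
    using N by (simp add: norm_mult) (simp add: w_def cmod_def)
  have sq: "(sqrt (k1\<^sup>2 + k2\<^sup>2) * N)\<^sup>2 = (k1 * N)\<^sup>2 + (k2 * N)\<^sup>2"
    by (simp add: power_mult_distrib distrib_right)
  have Re_sq: "(k1 * N)\<^sup>2 \<le> (Re z)\<^sup>2" and Im_sq: "(k2 * N)\<^sup>2 \<le> (Im z)\<^sup>2"
    using Re_ge Im_ge N assms(4,5) by (auto intro!: power_mono)
  have "(sqrt (k1\<^sup>2 + k2\<^sup>2) * N)\<^sup>2 \<le> (cmod z)\<^sup>2"
    unfolding sq cmod_power2 using Re_sq Im_sq by (rule add_mono)
  then have le_z: "sqrt (k1\<^sup>2 + k2\<^sup>2) * N \<le> cmod z"
    by (rule power2_le_imp_le) simp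
  have z_le: "cmod z \<le> norm I"
    unfolding z_def by (rule cmod_cinner_le[OF assms(2)])
  have "I = (w * complex_of_real N) *\<^sub>C e" if eq: "sqrt (k1\<^sup>2 + k2\<^sup>2) * N = norm I"
  proof -
    \<comment> \<open>\<open>cmod z\<close> lies between the two sides of the inequality, so
      equality of the sides pins it to both.\<close>
    have z: "cmod z = norm I" "cmod z = sqrt (k1\<^sup>2 + k2\<^sup>2) * N"
      using eq le_z z_le by auto
    \<comment> \<open>The distance from \<open>I\<close> to its projection onto the line of
      \<open>e\<close> is now zero.\<close>
    have "I = z *\<^sub>C e"
      using norm_diff_projection[OF assms(2), of I] z(1) by (simp flip: z_def)
    moreover have "(k1 * N)\<^sup>2 + (k2 * N)\<^sup>2 = (Re z)\<^sup>2 + (Im z)\<^sup>2"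
      using z(2) sq cmod_power2[of z] by simp
    \<comment> \<open>Two termwise inequalities whose sums agree must both be equalities.\<close>
    then have "(Re z)\<^sup>2 = (k1 * N)\<^sup>2" "(Im z)\<^sup>2 = (k2 * N)\<^sup>2"
      using Re_sq Im_sq by auto
    \<comment> \<open>All four quantities are nonnegative, so equal squares leave no sign
      ambiguity.\<close>
    then have "Re z = k1 * N" "Im z = k2 * N"
      using order_trans[OF _ Re_ge] order_trans[OF _ Im_ge] N assms(4,5)
      by (simp_all add: power2_eq_iff_nonneg)
    then have "z = w * complex_of_real N"
      by (simp add: w_def complex_eq_iff)
    ultimately show ?thesis
      by simp
  qed
  moreover have "sqrt (k1\<^sup>2 + k2\<^sup>2) * N = norm I" if "I = (w * complex_of_real N) *\<^sub>C e"
    using that norm_w assms(2) by (simp add: norm_scaleC)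
  ultimately show ?thesis
    using le_z z_le unfolding I_def N_def w_def by auto
qed

end
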